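(* Assume the Continuum Hypothesis. If $X$ is a compact $T_2$ space all of whose points are $G_\delta$ (i.e. $\{p\}$ is a countable intersection of open subsets of $X$ for every $p\in X$), then $X$ is indestructible.
   Context: A forcing notion $\mathbb P$ is countably closed if every decreasing sequence in $\mathbb P$ indexed by a countable ordinal has a lower bound in $\mathbb P$. If $\langle X,\mathcal T\rangle$ is a topological space in the ground model, then in a forcing extension $X$ is regarded as a space with the topology that has $\mathcal T$ as an open base. A Lindelöf space is indestructible if it remains Lindelöf (in this sense) in every forcing extension by a countably closed forcing notion. *)

theory Defs
  imports "HOL-Analysis.Analysis" "HOL-Library.Equipollence"
begin

definition continuum_hypothesis :: bool where
  "continuum_hypothesis \<longleftrightarrow>
     (\<forall>A :: real set. countable A \<or> A \<approx> (UNIV :: real set))"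

text \<open>
  The ground model is the universe of HOL.  A notion of forcing is a nonempty preordered set
  (neither antisymmetry nor a largest condition is required); \<open>p \<preceq> q\<close> means that \<open>p\<close> is
  stronger than \<open>q\<close>.

  A sentence of the forcing language is identified with the predicate of conditions forcing it, so
  \<open>\<phi> p\<close> is read ``\<open>p\<close> forces \<open>\<phi>\<close>''.  The connectives are the usual
  clauses of the recursive definition of the forcing relation.  Since the Lindeloef property of a
  space mentions only points, sets of points, families of sets of points and sequences of sets of
  points, only names for such objects occur:

  \<^item> a name for a subset of the ground model set \<open>S\<close> is a subset of \<open>S \<times> P\<close>, the first components
    standing for the canonical names of the elements of \<open>S\<close>;
  \<^item> a name for a family of subsets of \<open>S\<close> is a set of pairs \<open>(\<sigma>, q)\<close> with \<open>\<sigma>\<close> a name for a subset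
    of \<open>S\<close> and \<open>q \<in> P\<close>;
  \<^item> a name for a sequence of subsets of \<open>S\<close> is a name for a subset of \<open>\<omega> \<times> S\<close>, the terms of the
    sequence being its sections.

  Every such object of the forcing extension has a name of this form, so quantifying over these
  names is quantifying over all objects of the respective kind in the extension.
\<close>

locale forcing_notion =
  fixes P :: "'p set" and le :: "'p \<Rightarrow> 'p \<Rightarrow> bool" (infix "\<preceq>" 50)
  assumes nonempty: "P \<noteq> {}"
    and refl: "p \<in> P \<Longrightarrow> p \<preceq> p"
    and trans: "\<lbrakk>p \<in> P; q \<in> P; r \<in> P; p \<preceq> q; q \<preceq> r\<rbrakk> \<Longrightarrow> p \<preceq> r"
begin

text \<open>
  Up to isomorphism the countable ordinals are the well-orders of sets of natural numbers.
\<close>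

definition countably_closed :: bool where
  "countably_closed \<longleftrightarrow>
     (\<forall>(r :: nat rel) (f :: nat \<Rightarrow> 'p).
        Well_order r \<and> f ` Field r \<subseteq> P \<and> (\<forall>(i, j) \<in> r. f j \<preceq> f i) \<longrightarrow>
        (\<exists>b \<in> P. \<forall>i \<in> Field r. b \<preceq> f i))"

definition dense_below :: "('p \<Rightarrow> bool) \<Rightarrow> 'p \<Rightarrow> bool" where
  "dense_below D p \<longleftrightarrow> (\<forall>q \<in> P. q \<preceq> p \<longrightarrow> (\<exists>r \<in> P. r \<preceq> q \<and> D r))"

definition f_and :: "('p \<Rightarrow> bool) \<Rightarrow> ('p \<Rightarrow> bool) \<Rightarrow> 'p \<Rightarrow> bool" where
  "f_and \<phi> \<psi> p \<longleftrightarrow> \<phi> p \<and> \<psi> p"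

definition f_imp :: "('p \<Rightarrow> bool) \<Rightarrow> ('p \<Rightarrow> bool) \<Rightarrow> 'p \<Rightarrow> bool" where
  "f_imp \<phi> \<psi> p \<longleftrightarrow> (\<forall>q \<in> P. q \<preceq> p \<longrightarrow> \<phi> q \<longrightarrow> \<psi> q)"

text \<open>
  The range \<open>A\<close> of a quantifier is either a set of names, or a set of ground model objects; in the
  latter case the quantifier ranges over the canonical name of \<open>A\<close>.
\<close>

definition f_all :: "'n set \<Rightarrow> ('n \<Rightarrow> 'p \<Rightarrow> bool) \<Rightarrow> 'p \<Rightarrow> bool" where
  "f_all A \<phi> p \<longleftrightarrow> (\<forall>x \<in> A. \<phi> x p)"

definition f_ex :: "'n set \<Rightarrow> ('n \<Rightarrow> 'p \<Rightarrow> bool) \<Rightarrow> 'p \<Rightarrow> bool" where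
  "f_ex A \<phi> p \<longleftrightarrow> dense_below (\<lambda>q. \<exists>x \<in> A. \<phi> x q) p"

definition set_names :: "'a set \<Rightarrow> ('a \<times> 'p) set set" where
  "set_names S = Pow (S \<times> P)"

definition family_names :: "'a set \<Rightarrow> (('a \<times> 'p) set \<times> 'p) set set" where
  "family_names S = Pow (set_names S \<times> P)"

definition seq_names :: "'a set \<Rightarrow> ((nat \<times> 'a) \<times> 'p) set set" where
  "seq_names S = set_names (UNIV \<times> S)"

definition seq_term :: "((nat \<times> 'a) \<times> 'p) set \<Rightarrow> nat \<Rightarrow> ('a \<times> 'p) set" where
  "seq_term s n = {(x, q). ((n, x), q) \<in> s}"

text \<open>\<open>f_mem x \<sigma>\<close> is the sentence that the ground model object \<open>x\<close> belongs to \<open>\<sigma>\<close>.\<close>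

definition f_mem :: "'a \<Rightarrow> ('a \<times> 'p) set \<Rightarrow> 'p \<Rightarrow> bool" where
  "f_mem x \<sigma> = dense_below (\<lambda>r. \<exists>s. (x, s) \<in> \<sigma> \<and> r \<preceq> s)"

definition f_eq :: "'a set \<Rightarrow> ('a \<times> 'p) set \<Rightarrow> ('a \<times> 'p) set \<Rightarrow> 'p \<Rightarrow> bool" where
  "f_eq S \<sigma> \<tau> =
     f_all S (\<lambda>x. f_and (f_imp (f_mem x \<sigma>) (f_mem x \<tau>)) (f_imp (f_mem x \<tau>) (f_mem x \<sigma>)))"

definition f_mem_family ::
  "'a set \<Rightarrow> ('a \<times> 'p) set \<Rightarrow> (('a \<times> 'p) set \<times> 'p) set \<Rightarrow> 'p \<Rightarrow> bool" where
  "f_mem_family S \<sigma> \<U> = dense_below (\<lambda>r. \<exists>(\<tau>, s) \<in> \<U>. r \<preceq> s \<and> f_eq S \<sigma> \<tau> r)"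

definition f_subfamily ::
  "'a set \<Rightarrow> (('a \<times> 'p) set \<times> 'p) set \<Rightarrow> (('a \<times> 'p) set \<times> 'p) set \<Rightarrow> 'p \<Rightarrow> bool" where
  "f_subfamily S \<V> \<U> =
     f_all (set_names S) (\<lambda>\<sigma>. f_imp (f_mem_family S \<sigma> \<V>) (f_mem_family S \<sigma> \<U>))"

definition f_covers :: "'a set \<Rightarrow> (('a \<times> 'p) set \<times> 'p) set \<Rightarrow> 'p \<Rightarrow> bool" where
  "f_covers S \<U> =
     f_all S (\<lambda>x. f_ex (set_names S) (\<lambda>\<sigma>. f_and (f_mem_family S \<sigma> \<U>) (f_mem x \<sigma>)))"

text \<open>\<open>\<V>\<close> is countable: its elements all occur in one sequence of subsets of \<open>S\<close>.\<close>

definition f_countable :: "'a set \<Rightarrow> (('a \<times> 'p) set \<times> 'p) set \<Rightarrow> 'p \<Rightarrow> bool" where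
  "f_countable S \<V> =
     f_ex (seq_names S) (\<lambda>s.
       f_all (set_names S) (\<lambda>\<sigma>.
         f_imp (f_mem_family S \<sigma> \<V>) (f_ex UNIV (\<lambda>n. f_eq S \<sigma> (seq_term s n)))))"

text \<open>
  \<open>\<sigma>\<close> is open in the topology, computed in the extension, that has the ground model open sets
  as a base: each of its points lies in a ground model open set \<open>B\<close> contained in \<open>\<sigma>\<close>.
\<close>

definition f_open :: "'a topology \<Rightarrow> ('a \<times> 'p) set \<Rightarrow> 'p \<Rightarrow> bool" where
  "f_open X \<sigma> =
     f_all (topspace X) (\<lambda>x.
       f_imp (f_mem x \<sigma>)
         (f_ex {B. openin X B \<and> x \<in> B} (\<lambda>B. f_all B (\<lambda>y. f_mem y \<sigma>))))"

definition f_open_family ::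
  "'a topology \<Rightarrow> (('a \<times> 'p) set \<times> 'p) set \<Rightarrow> 'p \<Rightarrow> bool" where
  "f_open_family X \<U> =
     f_all (set_names (topspace X)) (\<lambda>\<sigma>. f_imp (f_mem_family (topspace X) \<sigma> \<U>) (f_open X \<sigma>))"

definition f_Lindelof :: "'a topology \<Rightarrow> 'p \<Rightarrow> bool" where
  "f_Lindelof X =
     f_all (family_names (topspace X)) (\<lambda>\<U>.
       f_imp (f_and (f_open_family X \<U>) (f_covers (topspace X) \<U>))
         (f_ex (family_names (topspace X)) (\<lambda>\<V>.
            f_and (f_subfamily (topspace X) \<V> \<U>)
              (f_and (f_countable (topspace X) \<V>) (f_covers (topspace X) \<V>)))))"

text \<open>Truth in every forcing extension by \<open>P\<close> is being forced by every condition.\<close>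

definition Lindelof_in_extensions :: "'a topology \<Rightarrow> bool" where
  "Lindelof_in_extensions X \<longleftrightarrow> (\<forall>p \<in> P. f_Lindelof X p)"

end

text \<open>
  A HOL definition cannot quantify over types, so the type of the conditions is a parameter;
  indestructibility is the statement for a free type variable \<open>'p\<close>.
\<close>

definition indestructible :: "'p itself \<Rightarrow> 'a topology \<Rightarrow> bool" where
  "indestructible _ X \<longleftrightarrow>
     Lindelof_space X \<and>
     (\<forall>(P :: 'p set) le.
        forcing_notion P le \<and> forcing_notion.countably_closed P le \<longrightarrow>
        forcing_notion.Lindelof_in_extensions P le X)"

end

theory Submission
  imports Defs
begin

text \<open>
  By Arhangel'skii's argument \<open>X\<close> has at most continuum many points: a set closed under limits of
  sequences, and under choosing a point outside a finite union of basic neighbourhoods of its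
  points whenever there is one, is compact and cannot miss a point.  Under CH the points can
  therefore be well-ordered with countable initial segments.  Along this order a countably closed
  forcing admits a descending family of conditions, the one at \<open>x\<close> deciding a ground model open
  neighbourhood of \<open>x\<close> inside some member of the given cover.  These neighbourhoods cover \<open>X\<close> in the
  ground model, and finitely many of them suffice; the strongest of the corresponding conditions
  forces that finitely many members of the cover suffice.
\<close>

section \<open>Well-orders with countable initial segments\<close>

text \<open>The order is the initial ordinal of \<open>A\<close> without its diagonal, so each
  proper initial segment is smaller than \<open>A\<close>. An uncountable one would have the size of
  the reals by CH and so admit an injection from \<open>A\<close>.\<close>

lemma continuum_hypothesis_wf_order:
  fixes A :: "'a set"
  assumes CH: "continuum_hypothesis" and A: "A \<lesssim> (UNIV :: real set)"
  obtains R :: "'a rel"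
  where "wf R" "trans R" "\<And>x y. x \<in> A \<Longrightarrow> y \<in> A \<Longrightarrow> x \<noteq> y \<Longrightarrow> (x, y) \<in> R \<or> (y, x) \<in> R"
    "R \<subseteq> A \<times> A" "\<And>x. x \<in> A \<Longrightarrow> countable {y. (y, x) \<in> R}"
proof -
  let ?r = "card_of A"
  have wo: "well_order_on A ?r"
    by (rule card_of_well_order_on)
  show thesis
  proof (rule that[of "?r - Id"])
    show "wf (?r - Id)"
      using wo by (simp add: well_order_on_def)
    have "trans ?r" "antisym ?r"
      using wo by (simp_all add: order_on_defs)
    then show "trans (?r - Id)"
      by (rule trans_diff_Id)
    show "(x, y) \<in> ?r - Id \<or> (y, x) \<in> ?r - Id" if "x \<in> A" "y \<in> A" "x \<noteq> y" for x y
      using wo that by (auto simp: order_on_defs total_on_def)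
    show "?r - Id \<subseteq> A \<times> A"
      using well_order_on_domain[OF wo] by auto
    show "countable {y. (y, x) \<in> ?r - Id}" if "x \<in> A" for x
    proof (rule ccontr)
      let ?S = "{y. (y, x) \<in> ?r - Id}"
      assume unc: "uncountable ?S"
      have "?S = underS ?r x"
        by (auto simp: underS_def)
      then have less: "(card_of ?S, ?r) \<in> ordLess"
        using card_of_underS[OF card_of_Card_order[of A], of x] that by (simp add: Field_card_of)
      obtain f :: "'a \<Rightarrow> real" where f: "inj_on f A"
        using A by (auto simp: lepoll_def)
      have "?S \<subseteq> A"
        using well_order_on_domain[OF wo] by auto
      then have fS: "inj_on f ?S"
        using f inj_on_subset by blast
      have "uncountable (f ` ?S)"
        using unc fS countable_image_inj_on by blast
      then have "f ` ?S \<approx> (UNIV :: real set)"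
        using CH by (auto simp: continuum_hypothesis_def)
      moreover have "?S \<approx> f ` ?S"
        using fS inj_on_image_eqpoll_self eqpoll_sym by blast
      ultimately have "A \<lesssim> ?S"
        using A by (meson eqpoll_imp_lepoll eqpoll_sym lepoll_trans)
      then have "(?r, card_of ?S) \<in> ordLeq"
        by (simp add: lepoll_def card_of_ordLeq)
      with less show False
        using not_ordLess_ordLeq by blast
    qed
  qed
qed

section \<open>Closing off under operations on sequences\<close>

text \<open>
  Terms built from a constant by \<open>\<omega>\<close>-ary operations with parameters in \<open>\<omega>\<^sup>\<omega>\<close>.  A term is
  determined by the labels along its finite paths, so there are only continuum many, and the values
  of all terms form the closure without any transfinite iteration.
\<close>

datatype seq_tree = Leaf | Node "nat \<Rightarrow> nat" "nat \<Rightarrow> seq_tree"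

primrec tree_labels :: "seq_tree \<Rightarrow> nat list \<Rightarrow> nat \<Rightarrow> nat" where
  "tree_labels Leaf = (\<lambda>p n. 0)"
| "tree_labels (Node k f) =
     (\<lambda>p. case p of [] \<Rightarrow> case_nat 1 k | m # q \<Rightarrow> tree_labels (f m) q)"

text \<open>The root label starts with 0 for \<open>Leaf\<close> and 1 for \<open>Node\<close> and
  continues with the parameter \<open>k\<close>; paths through \<open>m\<close> carry the labels of
  the \<open>m\<close>-th subtree. Induction recovers the whole tree.\<close>

lemma inj_tree_labels: "inj tree_labels"
proof (rule injI)
  show "s = t" if "tree_labels s = tree_labels t" for s t
    using that
  proof (induction s arbitrary: t)
    case Leaf
    have "tree_labels t [] 0 = 0"
      by (simp flip: Leaf)
    then show ?case
      by (cases t) auto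
  next
    case (Node k f)
    have root: "tree_labels t [] = case_nat 1 k"
      by (simp flip: Node.prems)
    obtain k' f' where t: "t = Node k' f'"
      using fun_cong[OF root, of 0] by (cases t) auto
    have "k n = k' n" for n
      using fun_cong[OF root, of "Suc n"] t by simp
    moreover have "f m = f' m" for m
    proof (rule Node.IH[OF rangeI])
      show "tree_labels (f m) = tree_labels (f' m)"
      proof
        show "tree_labels (f m) q = tree_labels (f' m) q" for q
          using fun_cong[OF Node.prems, of "m # q"] t by simp
      qed
    qed
    ultimately show ?case
      using t by auto
  qed
qed

lemma seq_tree_lepoll_reals: "(UNIV :: seq_tree set) \<lesssim> (UNIV :: real set)"
proof -
  \<comment> \<open>A tree is coded by the graph of its labelling, a subset of a countable set that
    \<open>to_nat\<close> moves into the naturals.\<close>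
  define g :: "seq_tree \<Rightarrow> nat set"
    where "g t = to_nat ` {(p, n, m). tree_labels t p n = m}" for t
  have "inj g"
  proof (rule injI)
    fix s t assume "g s = g t"
    then have "{(p, n, m). tree_labels s p n = m} = {(p, n, m). tree_labels t p n = m}"
      unfolding g_def by (simp add: inj_image_eq_iff)
    then have "tree_labels s = tree_labels t"
      by (auto simp: fun_eq_iff set_eq_iff)
    then show "s = t"
      using inj_tree_labels by (simp add: inj_eq)
  qed
  then have "(UNIV :: seq_tree set) \<lesssim> (UNIV :: nat set set)"
    by (auto simp: lepoll_def)
  then show ?thesis
    using nat_sets_eqpoll_reals lepoll_trans1 lepoll_trans2 by blast
qed

primrec tree_value :: "((nat \<Rightarrow> nat) \<Rightarrow> (nat \<Rightarrow> 'a) \<Rightarrow> 'a) \<Rightarrow> 'a \<Rightarrow> seq_tree \<Rightarrow> 'a" where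
  "tree_value F a Leaf = a"
| "tree_value F a (Node k f) = F k (\<lambda>n. tree_value F a (f n))"

text \<open>A sequence of tree values comes from a sequence of trees, which are the sons of one
  \<open>Node\<close>. The last conclusion lets \<open>A\<close> inherit whatever holds of
  \<open>a\<close> and of all values of \<open>F\<close>.\<close>

lemma closed_under_sequence_operation:
  fixes F :: "(nat \<Rightarrow> nat) \<Rightarrow> (nat \<Rightarrow> 'a) \<Rightarrow> 'a"
  obtains A where "a \<in> A" "A \<lesssim> (UNIV :: real set)"
    "\<And>k s. range s \<subseteq> A \<Longrightarrow> F k s \<in> A" "A \<subseteq> insert a (range (case_prod F))"
proof -
  let ?val = "tree_value F a"
  show thesis
  proof (rule that[of "range ?val"])
    show "a \<in> range ?val"
      by (metis rangeI tree_value.simps(1))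
    show "range ?val \<lesssim> (UNIV :: real set)"
      using image_lepoll lepoll_trans seq_tree_lepoll_reals by blast
    show "F k s \<in> range ?val" if "range s \<subseteq> range ?val" for k s
    proof -
      have "\<forall>n. \<exists>t. s n = ?val t"
        using that by auto
      then obtain f where "s = (\<lambda>n. ?val (f n))"
        by metis
      then have "F k s = ?val (Node k f)"
        by simp
      then show ?thesis
        by (metis rangeI)
    qed
    have "?val t \<in> insert a (range (case_prod F))" for t
      by (cases t) (auto simp: image_iff)
    then show "range ?val \<subseteq> insert a (range (case_prod F))"
      by auto
  qed
qed

section \<open>Cardinality of compact Hausdorff spaces with \<open>G\<^sub>\<delta>\<close> points\<close>

lemma compactin_finite_indexed_subcover:
  assumes "compactin X K" "\<And>i. i \<in> I \<Longrightarrow> openin X (B i)" "K \<subseteq> (\<Union>i\<in>I. B i)"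
  obtains N where "finite N" "N \<subseteq> I" "K \<subseteq> (\<Union>i\<in>N. B i)"
proof -
  obtain \<F> where \<F>: "finite \<F>" "\<F> \<subseteq> B ` I" "K \<subseteq> \<Union>\<F>"
    using compactinD[OF assms(1), of "B ` I"] assms(2,3) by auto
  then obtain N where "N \<subseteq> I" "finite N" "\<F> = B ` N"
    using finite_subset_image[OF \<F>(1,2)] by auto
  then show thesis
    using that \<F>(3) by auto
qed

text \<open>Regularity shrinks the open sets around \<open>x\<close> to closed neighbourhoods
  \<open>K n\<close> that still meet only in \<open>x\<close>. Their complements cover the compact
  complement of \<open>W\<close>, so finitely many \<open>K n\<close> already meet inside
  \<open>W\<close>.\<close>

lemma compact_Hausdorff_gdelta_point_base:
  assumes "compact_space X" "Hausdorff_space X" and x: "gdelta_in X {x}"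
  obtains V :: "nat \<Rightarrow> 'a set"
  where "\<And>n. openin X (V n)" "\<And>n. x \<in> V n" "decseq V"
    "\<And>W. openin X W \<Longrightarrow> x \<in> W \<Longrightarrow> \<exists>n. V n \<subseteq> W"
proof -
  obtain C :: "nat \<Rightarrow> 'a set" where C: "\<And>n. openin X (C n)" "\<Inter>(range C) = {x}"
    using x unfolding gdelta_in_descending by metis
  have "regular_space X"
    using assms compact_Hausdorff_imp_regular_space by blast
  have "\<exists>U K. openin X U \<and> closedin X K \<and> x \<in> U \<and> U \<subseteq> K \<and> K \<subseteq> C n" for n
  proof -
    have "openin X (C n) \<and> x \<in> C n"
      using C by blast
    with \<open>regular_space X\<close> show ?thesis
      unfolding neighbourhood_base_of_closedin[symmetric] neighbourhood_base_of by blast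
  qed
  then obtain U K where UK: "\<And>n. openin X (U n)" "\<And>n. closedin X (K n)" "\<And>n. x \<in> U n"
      "\<And>n. U n \<subseteq> K n" "\<And>n. K n \<subseteq> C n"
    by metis
  have K: "\<Inter>(range K) \<subseteq> {x}"
    unfolding C(2)[symmetric] using UK(5) by fast
  let ?V = "\<lambda>n. \<Inter>i\<in>{..n}. U i"
  show thesis
  proof (rule that[of ?V])
    show "openin X (?V n)" for n
      using UK by (intro openin_INT2) auto
    show "x \<in> ?V n" for n
      using UK by auto
    show "decseq ?V"
      by (auto simp: decseq_def)
    fix W assume W: "openin X W" "x \<in> W"
    have "compactin X (topspace X - W)"
      using W assms(1) by (intro closedin_compact_space) auto
    moreover have "openin X (topspace X - K n)" for n
      using UK(2) by blast
    moreover have "topspace X - W \<subseteq> (\<Union>n. topspace X - K n)"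
      using K W(2) by blast
    ultimately obtain N where N: "finite N" "topspace X - W \<subseteq> (\<Union>n\<in>N. topspace X - K n)"
      by (rule compactin_finite_indexed_subcover)
    \<comment> \<open>Inserting 0 keeps the maximum defined for empty \<open>N\<close>, which is
      possible when \<open>W\<close> is the whole space.\<close>
    have "?V (Max (insert 0 N)) \<subseteq> W"
    proof
      fix y assume y: "y \<in> ?V (Max (insert 0 N))"
      then have "y \<in> K n" if "n \<in> N" for n
        using UK(4)[of n] that N(1) by auto
      moreover have "y \<in> topspace X"
        using y UK(1) openin_subset by blast
      ultimately show "y \<in> W"
        using N(2) by blast
    qed
    then show "\<exists>n. ?V n \<subseteq> W" ..
  qed
qed

lemma compact_Hausdorff_gdelta_points_lepoll_reals:
  fixes X :: "'a topology"
  assumes comp: "compact_space X" and haus: "Hausdorff_space X"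
    and gd: "\<And>x. x \<in> topspace X \<Longrightarrow> gdelta_in X {x}"
  shows "topspace X \<lesssim> (UNIV :: real set)"
proof (cases "topspace X = {}")
  case True
  then show ?thesis
    by (simp add: empty_lepoll)
next
  case False
  then obtain a where a: "a \<in> topspace X"
    by blast
  define base where "base x V \<longleftrightarrow> (\<forall>n. openin X (V n) \<and> x \<in> V n) \<and> decseq V \<and>
      (\<forall>W. openin X W \<longrightarrow> x \<in> W \<longrightarrow> (\<exists>n. V n \<subseteq> W))" for x and V :: "nat \<Rightarrow> 'a set"
  have "\<exists>V. base x V" if x: "x \<in> topspace X" for x
  proof -
    obtain V where "\<And>n. openin X (V n)" "\<And>n. x \<in> V n" "decseq V"
        "\<And>W. openin X W \<Longrightarrow> x \<in> W \<Longrightarrow> \<exists>n. V n \<subseteq> W"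
      by (rule compact_Hausdorff_gdelta_point_base[OF comp haus gd[OF x]]) blast
    then show ?thesis
      unfolding base_def by blast
  qed
  then obtain V where base: "\<And>x. x \<in> topspace X \<Longrightarrow> base x (V x)"
    by metis
  have V: "openin X (V x n)" "x \<in> V x n" "decseq (V x)"
      "openin X W \<Longrightarrow> x \<in> W \<Longrightarrow> \<exists>n. V x n \<subseteq> W" if "x \<in> topspace X" for x n W
    using base[OF that] by (simp_all add: base_def)
  \<comment> \<open>The number \<open>k 0\<close> says how many neighbourhoods are removed, and
    \<open>k (Suc i)\<close> selects the one at \<open>s i\<close>.\<close>
  define out where "out k s = topspace X - (\<Union>i<k 0. V (s i) (k (Suc i)))"
    for k :: "nat \<Rightarrow> nat" and s
  \<comment> \<open>One operation performs both closures: \<open>k 0 = 0\<close> requests a limit of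
    \<open>s\<close>, a positive \<open>k 0\<close> a point of \<open>out k s\<close>. The value
    \<open>a\<close> is the default when there is none.\<close>
  define F where "F k s =
      (if k 0 = 0 then if \<exists>l. limitin X s l sequentially then SOME l. limitin X s l sequentially else a
       else if out k s \<noteq> {} then SOME y. y \<in> out k s else a)" for k s
  obtain A where A: "a \<in> A" "A \<lesssim> (UNIV :: real set)"
      "\<And>k s. range s \<subseteq> A \<Longrightarrow> F k s \<in> A" "A \<subseteq> insert a (range (case_prod F))"
    using closed_under_sequence_operation[of a F] by metis
  have "F k s \<in> topspace X" for k s
  proof -
    have "(SOME l. limitin X s l sequentially) \<in> topspace X" if "\<exists>l. limitin X s l sequentially"
      using someI_ex[OF that] limitin_topspace by fast
    moreover have "(SOME y. y \<in> out k s) \<in> topspace X" if "out k s \<noteq> {}"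
      using some_in_eq[of "out k s"] that by (auto simp: out_def)
    ultimately show ?thesis
      using a by (auto simp: F_def)
  qed
  then have AX: "A \<subseteq> topspace X"
    using A(4) a by auto
  have "X closure_of A \<subseteq> A"
  proof
    fix x assume x: "x \<in> X closure_of A"
    then have xX: "x \<in> topspace X"
      by (simp add: in_closure_of)
    \<comment> \<open>The decreasing base at \<open>x\<close> yields a sequence in \<open>A\<close>
      converging to \<open>x\<close>; as limits are unique, the choice made in \<open>F\<close> is
      \<open>x\<close> itself.\<close>
    have "\<exists>y. y \<in> A \<and> y \<in> V x n" for n
      using x V(1,2)[OF xX, of n] by (auto simp: in_closure_of)
    then obtain s where s: "\<And>n. s n \<in> A" "\<And>n. s n \<in> V x n"
      by metis
    have lim: "limitin X s x sequentially"
      unfolding limitin_sequentially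
    proof (intro conjI xX allI impI)
      fix W assume "openin X W \<and> x \<in> W"
      then obtain N where "V x N \<subseteq> W"
        using V(4) xX by blast
      then have "\<forall>n\<ge>N. s n \<in> W"
        using s(2) decseqD[OF V(3)[OF xX]] by blast
      then show "\<exists>N. \<forall>n\<ge>N. s n \<in> W" ..
    qed
    then have "F (\<lambda>_. 0) s = x"
      unfolding F_def
      using limitin_Hausdorff_unique[OF _ lim _ haus] someI[of "\<lambda>l. limitin X s l sequentially", OF lim]
      by auto
    then show "x \<in> A"
      using A(3)[of s "\<lambda>_. 0"] s(1) by auto
  qed
  then have "closedin X A"
    using AX closure_of_subset_eq by blast
  then have compA: "compactin X A"
    using comp closedin_compact_space by blast
  have "topspace X \<subseteq> A"
  proof (rule ccontr)
    assume "\<not> topspace X \<subseteq> A"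
    then obtain q where q: "q \<in> topspace X" "q \<notin> A"
      by auto
    have "\<exists>n. q \<notin> V x n" if "x \<in> A" for x
    proof -
      have "openin X (topspace X - {q})" "x \<in> topspace X - {q}"
        using q that AX haus by (auto simp: closedin_Hausdorff_singleton)
      then show ?thesis
        using V(4)[of x "topspace X - {q}"] by blast
    qed
    then obtain m where m: "\<And>x. x \<in> A \<Longrightarrow> q \<notin> V x (m x)"
      by metis
    have "openin X (V x (m x))" if "x \<in> A" for x
      using V(1) AX that by blast
    moreover have "A \<subseteq> (\<Union>x\<in>A. V x (m x))"
      using V(2) AX by blast
    ultimately obtain B where B: "finite B" "B \<subseteq> A" "A \<subseteq> (\<Union>x\<in>B. V x (m x))"
      by (rule compactin_finite_indexed_subcover[OF compA])
    then obtain b where b: "set b = B"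
      using finite_list by blast
    \<comment> \<open>The finite cover becomes an argument of \<open>F\<close>: the list of centres
      is padded with \<open>a\<close>, and the indices in \<open>k\<close> are shifted by one since
      \<open>k 0\<close> holds the length.\<close>
    define s where "s i = (if i < length b then b ! i else a)" for i
    define k where "k i = (case i of 0 \<Rightarrow> length b | Suc i \<Rightarrow> m (s i))" for i
    \<comment> \<open>The cover is nonempty because \<open>a\<close> lies in \<open>A\<close>; thus
      \<open>k 0\<close> is positive and \<open>F\<close> takes its second branch.\<close>
    have "b \<noteq> []"
      using B b A(1) by auto
    have sA: "range s \<subseteq> A"
      using A(1) B(2) b by (auto simp: s_def)
    have "q \<in> out k s"
      using q m sA by (auto simp: out_def k_def)
    then have "out k s \<noteq> {}"
      by auto
    then have "F k s \<in> out k s"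
      using \<open>b \<noteq> []\<close> some_in_eq by (auto simp: F_def k_def)
    moreover have "A \<inter> out k s = {}"
    proof -
      have "A \<subseteq> (\<Union>i<length b. V (s i) (m (s i)))"
      proof
        fix y assume "y \<in> A"
        then obtain x where "x \<in> set b" "y \<in> V x (m x)"
          using B b by auto
        then show "y \<in> (\<Union>i<length b. V (s i) (m (s i)))"
          by (auto simp: in_set_conv_nth s_def intro!: bexI)
      qed
      then show ?thesis
        by (auto simp: out_def k_def)
    qed
    ultimately show False
      using A(3)[OF sA] by auto
  qed
  then show ?thesis
    using A(2) subset_imp_lepoll lepoll_trans by blast
qed

section \<open>Countably closed forcing\<close>

context forcing_notion
begin

section \<open>Basic rules of the forcing relation\<close>

lemma dense_belowD:
  assumes "dense_below D p" "p \<in> P"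
  obtains r where "r \<in> P" "r \<preceq> p" "D r"
  using assms refl unfolding dense_below_def by blast

lemma dense_below_mono:
  assumes "dense_below D p" "q \<in> P" "p \<in> P" "q \<preceq> p"
  shows "dense_below D q"
  using assms trans unfolding dense_below_def by blast

lemma dense_below_weaken:
  assumes "dense_below D p" "\<And>r. r \<in> P \<Longrightarrow> D r \<Longrightarrow> E r"
  shows "dense_below E p"
  using assms unfolding dense_below_def by blast

lemma dense_belowI:
  assumes "\<And>q. q \<in> P \<Longrightarrow> q \<preceq> p \<Longrightarrow> D q"
  shows "dense_below D p"
  using assms refl unfolding dense_below_def by blast

lemma f_mem_mono: "f_mem x \<sigma> p \<Longrightarrow> q \<in> P \<Longrightarrow> p \<in> P \<Longrightarrow> q \<preceq> p \<Longrightarrow> f_mem x \<sigma> q"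
  unfolding f_mem_def by (rule dense_below_mono)

lemma f_eq_refl: "f_eq S \<sigma> \<sigma> p"
  by (simp add: f_eq_def f_all_def f_and_def f_imp_def)

lemma f_mem_familyI:
  assumes "(\<sigma>, s) \<in> \<V>" "s \<in> P" "p \<in> P" "p \<preceq> s"
  shows "f_mem_family S \<sigma> \<V> p"
  unfolding f_mem_family_def using assms f_eq_refl trans by (intro dense_belowI) blast

lemma f_mem_family_mono:
  "f_mem_family S \<sigma> \<U> p \<Longrightarrow> q \<in> P \<Longrightarrow> p \<in> P \<Longrightarrow> q \<preceq> p \<Longrightarrow> f_mem_family S \<sigma> \<U> q"
  unfolding f_mem_family_def by (rule dense_below_mono)

lemma f_subfamily_subset: "\<V> \<subseteq> \<U> \<Longrightarrow> f_subfamily S \<V> \<U> p"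
  unfolding f_subfamily_def f_all_def f_imp_def f_mem_family_def
  by (auto elim!: dense_below_weaken)

text \<open>A list of the names occurring in \<open>\<V>\<close> becomes one name for a sequence,
  with empty sections past the end of the list. Below a condition forcing \<open>\<sigma>\<close>
  into \<open>\<V>\<close>, densely many conditions force it equal to a listed name.\<close>

lemma f_countable_finite:
  assumes \<V>: "finite \<V>" "\<V> \<in> family_names S"
  shows "f_countable S \<V> p"
proof -
  obtain v where v: "set v = fst ` \<V>"
    using \<V>(1) finite_list by (metis finite_imageI)
  define s where "s = {((n, x), q) | n x q. n < length v \<and> (x, q) \<in> v ! n}"
  have "v ! n \<in> set_names S" if "n < length v" for n
    using \<V>(2) v nth_mem[OF that] by (auto simp: family_names_def)
  then have s: "s \<in> seq_names S"
    by (fastforce simp: s_def seq_names_def set_names_def)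
  have nth: "seq_term s n = v ! n" if "n < length v" for n
    using that by (auto simp: seq_term_def s_def)
  show ?thesis
    unfolding f_countable_def f_ex_def f_all_def f_imp_def
  proof (rule dense_belowI, intro bexI[OF _ s] ballI impI)
    fix q \<sigma> q' assume q': "f_mem_family S \<sigma> \<V> q'"
    show "dense_below (\<lambda>q. \<exists>n\<in>UNIV. f_eq S \<sigma> (seq_term s n) q) q'"
      using q' unfolding f_mem_family_def
    proof (rule dense_below_weaken)
      fix r assume "\<exists>(\<tau>, s)\<in>\<V>. r \<preceq> s \<and> f_eq S \<sigma> \<tau> r"
      then obtain \<tau> where \<tau>: "\<tau> \<in> set v" "f_eq S \<sigma> \<tau> r"
        using v by force
      then show "\<exists>n\<in>UNIV. f_eq S \<sigma> (seq_term s n) r"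
        using nth by (metis UNIV_I in_set_conv_nth)
    qed
  qed
qed

section \<open>Descending families of conditions\<close>

lemma countable_chain_lower_bound:
  assumes cc: "countably_closed" and C: "countable C" "C \<subseteq> P" "C \<noteq> {}"
    and chain: "\<And>x y. x \<in> C \<Longrightarrow> y \<in> C \<Longrightarrow> x \<preceq> y \<or> y \<preceq> x"
  obtains b where "b \<in> P" "\<And>c. c \<in> C \<Longrightarrow> b \<preceq> c"
proof -
  obtain c :: "nat \<Rightarrow> 'p" where c: "range c = C"
    using C uncountable_def by blast
  \<comment> \<open>\<open>d\<close> is a running minimum of \<open>c\<close>: by the chain
    property, the next \<open>c\<close> is stronger whenever the old value is not below it.\<close>
  define d where "d = rec_nat (c 0) (\<lambda>n e. if e \<preceq> c (Suc n) then e else c (Suc n))"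
  have d: "d 0 = c 0" "d (Suc n) = (if d n \<preceq> c (Suc n) then d n else c (Suc n))" for n
    by (simp_all add: d_def)
  have dC: "d n \<in> C" for n
    by (induction n) (use c in \<open>auto simp: d\<close>)
  have CP: "x \<in> P" if "x \<in> C" for x
    using that C by auto
  have step: "d (Suc n) \<preceq> d n" for n
    using chain[of "d n" "c (Suc n)"] dC c refl CP by (auto simp: d)
  have mono: "d (n + k) \<preceq> d n" for n k
  proof (induction k)
    case 0
    show ?case
      using refl CP[OF dC] by simp
  next
    case (Suc k)
    then show ?case
      using trans[OF CP[OF dC] CP[OF dC] CP[OF dC] step] by simp
  qed
  have le: "d n \<preceq> c n" for n
    using dC c refl CP by (cases n) (auto simp: d)
  have "d ` Field natLeq \<subseteq> P" "\<forall>(i, j)\<in>natLeq. d j \<preceq> d i"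
    using dC CP mono by (auto simp: natLeq_def le_iff_add)
  then have "\<exists>b\<in>P. \<forall>i\<in>Field natLeq. b \<preceq> d i"
    using cc[unfolded countably_closed_def, rule_format, of natLeq d] natLeq_Well_order by blast
  then obtain b where b: "b \<in> P" "\<And>i. b \<preceq> d i"
    by (auto simp: Field_natLeq)
  have "b \<preceq> c n" for n
    using trans[OF b(1) CP[OF dC] CP b(2) le] c by blast
  then show thesis
    using that[of b] b(1) c by auto
qed

text \<open>
  The descending sequence is indexed by the points themselves: at \<open>x\<close> only the countably many
  earlier conditions have to be extended.
\<close>

lemma descending_dense_choice:
  fixes R :: "'a rel"
  assumes cc: "countably_closed" and R: "wf R" "trans R"
    and total: "\<And>x y. x \<in> A \<Longrightarrow> y \<in> A \<Longrightarrow> x \<noteq> y \<Longrightarrow> (x, y) \<in> R \<or> (y, x) \<in> R"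
    and RA: "R \<subseteq> A \<times> A" and ctbl: "\<And>x. x \<in> A \<Longrightarrow> countable {y. (y, x) \<in> R}"
    and p: "p \<in> P"
    and dense: "\<And>x q. x \<in> A \<Longrightarrow> q \<in> P \<Longrightarrow> q \<preceq> p \<Longrightarrow> \<exists>r\<in>P. r \<preceq> q \<and> D x r"
  shows "\<exists>f. (\<forall>x\<in>A. f x \<in> P \<and> f x \<preceq> p \<and> D x (f x)) \<and> (\<forall>x y. (y, x) \<in> R \<longrightarrow> f x \<preceq> f y)"
proof -
  \<comment> \<open>\<open>Q f x r\<close> admits \<open>r\<close> as the value at \<open>x\<close>
    when \<open>f\<close> gives the earlier values. It consults \<open>f\<close> only at
    predecessors of \<open>x\<close>, as recursion with choice along \<open>R\<close>
    requires.\<close>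
  define Q where "Q f x r \<longleftrightarrow>
      (x \<in> A \<longrightarrow> r \<in> P \<and> r \<preceq> p \<and> D x r \<and> (\<forall>y. (y, x) \<in> R \<longrightarrow> r \<preceq> f y))" for f x r
  have "\<exists>f. \<forall>x. Q f x (f x)"
  proof (rule dependent_wf_choice[OF R(1)])
    show "Q f x r = Q g x r" if "\<And>z. (z, x) \<in> R \<Longrightarrow> f z = g z" for f g x r
      using that by (auto simp: Q_def)
    fix x f assume IH: "\<And>y. (y, x) \<in> R \<Longrightarrow> Q f y (f y)"
    show "\<exists>r. Q f x r"
    proof (cases "x \<in> A")
      case True
      \<comment> \<open>Including \<open>p\<close> makes the set nonempty even at the first point
        and puts its lower bound below \<open>p\<close>.\<close>
      let ?C = "insert p (f ` {y. (y, x) \<in> R})"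
      have f: "f y \<in> P" "f y \<preceq> p" "\<And>z. (z, y) \<in> R \<Longrightarrow> f y \<preceq> f z" if "(y, x) \<in> R" for y
        using IH[OF that] that RA by (auto simp: Q_def)
      have "f y \<preceq> f z \<or> f z \<preceq> f y" if "(y, x) \<in> R" "(z, x) \<in> R" for y z
        using f total[of y z] that RA refl by (cases "y = z") blast+
      then have chain: "u \<preceq> v \<or> v \<preceq> u" if "u \<in> ?C" "v \<in> ?C" for u v
        using that f p refl by auto
      have "countable ?C" "?C \<subseteq> P" "?C \<noteq> {}"
        using ctbl[OF True] f p by auto
      then obtain b where b: "b \<in> P" "\<And>c. c \<in> ?C \<Longrightarrow> b \<preceq> c"
        using countable_chain_lower_bound[OF cc _ _ _ chain] by metis
      then obtain r where r: "r \<in> P" "r \<preceq> b" "D x r"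
        using dense[OF True] by blast
      have "r \<preceq> c" if "c \<in> ?C" for c
        using trans[OF r(1) b(1) _ r(2) b(2)[OF that]] that \<open>?C \<subseteq> P\<close> by blast
      then have "Q f x r"
        using r by (auto simp: Q_def)
      then show ?thesis ..
    qed (auto simp: Q_def)
  qed
  then obtain f where "\<And>x. Q f x (f x)"
    by blast
  then show ?thesis
    using RA unfolding Q_def by blast
qed

section \<open>From forced open covers to finite subcovers\<close>

text \<open>
  Instead of deciding a member of the cover around \<open>x\<close>, a stronger condition decides a ground
  model neighbourhood of \<open>x\<close> contained in a member that is given by an element of the name \<open>\<U>\<close>.
\<close>

lemma open_cover_decides_neighbourhood:
  assumes p: "p \<in> P" and \<U>: "\<U> \<in> family_names (topspace X)"
    and op: "f_open_family X \<U> p" and cov: "f_covers (topspace X) \<U> p"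
    and x: "x \<in> topspace X" and q: "q \<in> P" "q \<preceq> p"
  shows "\<exists>r\<in>P. r \<preceq> q \<and>
    (\<exists>B \<tau> s. openin X B \<and> x \<in> B \<and> (\<tau>, s) \<in> \<U> \<and> r \<preceq> s \<and> (\<forall>y\<in>B. f_mem y \<tau> r))"
proof -
  obtain r \<sigma> where r: "r \<in> P" "r \<preceq> q" and \<sigma>: "\<sigma> \<in> set_names (topspace X)"
      "f_mem_family (topspace X) \<sigma> \<U> r" "f_mem x \<sigma> r"
    using cov x q unfolding f_covers_def f_all_def f_ex_def f_and_def dense_below_def by meson
  have rp: "r \<preceq> p"
    using r q p trans by blast
  then have "f_open X \<sigma> r"
    using op \<sigma> r unfolding f_open_family_def f_all_def f_imp_def by blast
  then have "dense_below (\<lambda>r. \<exists>B\<in>{B. openin X B \<and> x \<in> B}. \<forall>y\<in>B. f_mem y \<sigma> r) r"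
    using \<sigma> x r refl unfolding f_open_def f_all_def f_imp_def f_ex_def by blast
  then obtain r1 where r1: "r1 \<in> P" "r1 \<preceq> r"
      and "\<exists>B\<in>{B. openin X B \<and> x \<in> B}. \<forall>y\<in>B. f_mem y \<sigma> r1"
    using r(1) by (rule dense_belowD)
  then obtain B where B: "openin X B" "x \<in> B" and mem: "\<And>y. y \<in> B \<Longrightarrow> f_mem y \<sigma> r1"
    by auto
  \<comment> \<open>The name \<open>\<sigma>\<close> need not occur in \<open>\<U>\<close>; a
    stronger condition forces it equal to some \<open>\<tau>\<close> that does.\<close>
  have "f_mem_family (topspace X) \<sigma> \<U> r1"
    using f_mem_family_mono[OF \<sigma>(2) r1(1) r(1) r1(2)] .
  then obtain r2 where r2: "r2 \<in> P" "r2 \<preceq> r1"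
      and "\<exists>(\<tau>, s)\<in>\<U>. r2 \<preceq> s \<and> f_eq (topspace X) \<sigma> \<tau> r2"
    unfolding f_mem_family_def using r1(1) by (rule dense_belowD)
  then obtain \<tau> s where \<tau>: "(\<tau>, s) \<in> \<U>" "r2 \<preceq> s" "f_eq (topspace X) \<sigma> \<tau> r2"
    by auto
  have "f_mem y \<tau> r2" if "y \<in> B" for y
  proof -
    have "y \<in> topspace X"
      using B that openin_subset by blast
    moreover have "f_mem y \<sigma> r2"
      by (rule f_mem_mono[OF mem[OF that] r2(1) r1(1) r2(2)])
    moreover have "r2 \<preceq> r2"
      by (rule refl[OF r2(1)])
    ultimately show ?thesis
      using \<tau>(3) r2(1) by (simp add: f_eq_def f_all_def f_and_def f_imp_def)
  qed
  moreover have "r2 \<preceq> q"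
    using trans[OF r2(1) r1(1) r(1) r2(2) r1(2)] trans[OF r2(1) r(1) q(1) _ r(2)] by blast
  ultimately show ?thesis
    using r2 B \<tau> by blast
qed

text \<open>As \<open>(\<tau>, s)\<close> lies in \<open>\<V>\<close> and \<open>p\<close> is below
  \<open>s\<close>, \<open>p\<close> already forces \<open>\<tau>\<close> into the family, and the
  same witness serves every \<open>q\<close> below \<open>p\<close>.\<close>

lemma f_covers_finite_family:
  assumes p: "p \<in> P" and \<V>: "\<V> \<in> family_names S"
    and cov: "\<And>x. x \<in> S \<Longrightarrow> \<exists>(\<tau>, s)\<in>\<V>. p \<preceq> s \<and> f_mem x \<tau> p"
  shows "f_covers S \<V> p"
  unfolding f_covers_def f_all_def f_ex_def f_and_def
proof (intro ballI dense_belowI)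
  fix x q assume "x \<in> S" and q: "q \<in> P" "q \<preceq> p"
  then obtain \<tau> s where \<tau>: "(\<tau>, s) \<in> \<V>" "p \<preceq> s" "f_mem x \<tau> p"
    using cov by blast
  then have "\<tau> \<in> set_names S" "s \<in> P"
    using \<V> by (auto simp: family_names_def)
  then show "\<exists>\<sigma>\<in>set_names S. f_mem_family S \<sigma> \<V> q \<and> f_mem x \<sigma> q"
    using \<tau> f_mem_familyI f_mem_mono p q trans by meson
qed

lemma compact_Lindelof_in_extensions:
  fixes X :: "'a topology"
  assumes cc: "countably_closed" and comp: "compact_space X"
    and R: "wf R" "trans R"
      "\<And>x y. x \<in> topspace X \<Longrightarrow> y \<in> topspace X \<Longrightarrow> x \<noteq> y \<Longrightarrow> (x, y) \<in> R \<or> (y, x) \<in> R"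
      "R \<subseteq> topspace X \<times> topspace X" "\<And>x. x \<in> topspace X \<Longrightarrow> countable {y. (y, x) \<in> R}"
  shows "Lindelof_in_extensions X"
  unfolding Lindelof_in_extensions_def f_Lindelof_def f_all_def[of "family_names _"] f_imp_def
proof (intro ballI impI)
  let ?S = "topspace X"
  fix p0 \<U> p assume \<U>: "\<U> \<in> family_names ?S" and p: "p \<in> P"
    and "f_and (f_open_family X \<U>) (f_covers ?S \<U>) p"
  then have op: "f_open_family X \<U> p" and cov: "f_covers ?S \<U> p"
    by (auto simp: f_and_def)
  define D where "D x r \<longleftrightarrow>
      (\<exists>B \<tau> s. openin X B \<and> x \<in> B \<and> (\<tau>, s) \<in> \<U> \<and> r \<preceq> s \<and> (\<forall>y\<in>B. f_mem y \<tau> r))" for x r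
  have dense: "\<exists>r\<in>P. r \<preceq> q \<and> D x r" if "x \<in> ?S" "q \<in> P" "q \<preceq> p" for x q
    using open_cover_decides_neighbourhood[OF p \<U> op cov that] by (simp add: D_def)
  show "f_ex (family_names ?S) (\<lambda>\<V>. f_and (f_subfamily ?S \<V> \<U>)
      (f_and (f_countable ?S \<V>) (f_covers ?S \<V>))) p"
    unfolding f_ex_def dense_below_def
  proof (intro ballI impI)
    \<comment> \<open>A forced existential needs witnesses densely below \<open>p\<close>, so the
      construction runs below an arbitrary \<open>q\<close>.\<close>
    fix q assume q: "q \<in> P" "q \<preceq> p"
    have dense_q: "\<exists>r\<in>P. r \<preceq> q' \<and> D x r" if "x \<in> ?S" "q' \<in> P" "q' \<preceq> q" for x q'
      using dense that q p trans by blast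
    have "\<exists>f. (\<forall>x\<in>?S. f x \<in> P \<and> f x \<preceq> q \<and> D x (f x)) \<and> (\<forall>x y. (y, x) \<in> R \<longrightarrow> f x \<preceq> f y)"
      by (rule descending_dense_choice[OF cc R(1,2)]) (fact R q(1) dense_q)+
    then obtain f where f: "\<And>x. x \<in> ?S \<Longrightarrow> f x \<in> P \<and> f x \<preceq> q \<and> D x (f x)"
        and desc: "\<And>x y. (y, x) \<in> R \<Longrightarrow> f x \<preceq> f y"
      by blast
    obtain B \<tau> s where B: "\<And>x. x \<in> ?S \<Longrightarrow> openin X (B x) \<and> x \<in> B x \<and> (\<tau> x, s x) \<in> \<U> \<and>
        f x \<preceq> s x \<and> (\<forall>y\<in>B x. f_mem y (\<tau> x) (f x))"
      using f unfolding D_def by metis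
    have "openin X (B x)" if "x \<in> ?S" for x
      using B that by blast
    moreover have "?S \<subseteq> (\<Union>x\<in>?S. B x)"
      using B by blast
    ultimately obtain N where N: "finite N" "N \<subseteq> ?S" "?S \<subseteq> (\<Union>x\<in>N. B x)"
      by (rule compactin_finite_indexed_subcover[OF comp[unfolded compact_space_def]])
    \<comment> \<open>The bound is the value of \<open>f\<close> at the \<open>R\<close>-last point
      of \<open>N\<close>, or \<open>q\<close> itself when \<open>N\<close> is empty.\<close>
    have "\<exists>r\<in>P. r \<preceq> q \<and> (\<forall>x\<in>N. r \<preceq> f x)"
      using N(1,2)
    proof (induction N)
      case empty
      then show ?case
        using q refl by auto
    next
      case (insert x N)
      then obtain r where r: "r \<in> P" "r \<preceq> q" "\<forall>y\<in>N. r \<preceq> f y"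
        by auto
      show ?case
      proof (cases "\<exists>y\<in>N. (x, y) \<in> R \<or> x = y")
        case True
        then obtain y where y: "y \<in> N" "f y \<preceq> f x"
          using desc insert.hyps by blast
        then have "r \<preceq> f x"
          using trans[of r "f y" "f x"] r f insert.prems by blast
        then show ?thesis
          using r by auto
      next
        case False
        then have "(y, x) \<in> R" if "y \<in> N" for y
          using R(3)[of x y] that insert.prems by auto
        then have "f x \<preceq> f y" if "y \<in> N" for y
          using desc that by blast
        then show ?thesis
          using f[of x] insert.prems refl by auto
      qed
    qed
    then obtain r where r: "r \<in> P" "r \<preceq> q" "\<And>x. x \<in> N \<Longrightarrow> r \<preceq> f x"
      by auto
    \<comment> \<open>Reusing pairs of \<open>\<U>\<close> makes this finite name a subset of
      \<open>\<U>\<close>, hence forced to be a subfamily.\<close>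
    let ?V = "(\<lambda>x. (\<tau> x, s x)) ` N"
    have sub: "?V \<subseteq> \<U>"
      using B N by auto
    then have V: "?V \<in> family_names ?S"
      using \<U> by (auto simp: family_names_def)
    have "f_covers ?S ?V r"
    proof (rule f_covers_finite_family[OF r(1) V])
      fix y assume "y \<in> ?S"
      then obtain x where x: "x \<in> N" "y \<in> B x"
        using N by auto
      then have xS: "x \<in> ?S"
        using N by auto
      have "s x \<in> P"
        using V x by (auto simp: family_names_def)
      then have "r \<preceq> s x"
        using trans[of r "f x" "s x"] r x B[OF xS] f[OF xS] by blast
      moreover have "f_mem y (\<tau> x) r"
        using f_mem_mono[of y "\<tau> x" "f x" r] r x B[OF xS] f[OF xS] by blast
      ultimately show "\<exists>(\<tau>, s)\<in>?V. r \<preceq> s \<and> f_mem y \<tau> r"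
        using x by auto
    qed
    moreover have "f_subfamily ?S ?V \<U> r" "f_countable ?S ?V r"
      using sub N V by (simp_all add: f_subfamily_subset f_countable_finite)
    ultimately show "\<exists>r\<in>P. r \<preceq> q \<and> (\<exists>\<V>\<in>family_names ?S. f_and (f_subfamily ?S \<V> \<U>)
        (f_and (f_countable ?S \<V>) (f_covers ?S \<V>)) r)"
      using r V unfolding f_and_def by blast
  qed
qed

end

theorem theorem1p15:
  fixes X :: "'a topology"
  assumes "continuum_hypothesis"
    and "compact_space X" and "Hausdorff_space X"
    and "\<And>x. x \<in> topspace X \<Longrightarrow> gdelta_in X {x}"
  shows "indestructible TYPE('p) X"
proof -
  have "topspace X \<lesssim> (UNIV :: real set)"
    using assms compact_Hausdorff_gdelta_points_lepoll_reals by blast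
  \<comment> \<open>The order is fixed in the ground model before any forcing is chosen, so it
    serves every \<open>P\<close>.\<close>
  then obtain R where R: "wf R" "trans R"
      "\<And>x y. x \<in> topspace X \<Longrightarrow> y \<in> topspace X \<Longrightarrow> x \<noteq> y \<Longrightarrow> (x, y) \<in> R \<or> (y, x) \<in> R"
      "R \<subseteq> topspace X \<times> topspace X" "\<And>x. x \<in> topspace X \<Longrightarrow> countable {y. (y, x) \<in> R}"
    using continuum_hypothesis_wf_order[OF assms(1)] by metis
  show ?thesis
    unfolding indestructible_def
  proof (intro conjI allI impI)
    show "Lindelof_space X"
      using assms compact_imp_Lindelof_space by blast
    show "forcing_notion.Lindelof_in_extensions P le X"
      if "forcing_notion P le \<and> forcing_notion.countably_closed P le" for P :: "'p set" and le
      using that forcing_notion.compact_Lindelof_in_extensions[OF _ _ assms(2) R] by blast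
  qed
qed

end
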